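(* Let $W$ be an $N\times N$ matrix weight with monic matrix valued orthogonal polynomials $P(x,n)$ and squared norms $\mathcal{H}(n)$. Suppose that for a constant matrix $A\in M_N(\mathbb{C})$ and a scalar polynomial $v(x)$ of degree $k$ the operator $\mathcal{D}=\partial_x+A$ has adjoint $\mathcal{D}^\dagger=-\mathcal{D}+v'(x)$ with respect to $W$. Let $M=\sum_{j=-k+1}^0A_j(n)\delta^j$, with $A_0(n)=A$ and $A_j(n)=(v'(L))_j(n)$ for $-k+1\le j\le -1$. Then there exists a unique difference operator $M^\dagger\in\mathcal{F}_L(P)$ such that $$M\cdot P=P\cdot\mathcal{D}\qquad\text{and}\qquad M^\dagger\cdot P=P\cdot\mathcal{D}^\dagger.$$ Moreover $$M^\dagger=\mathcal{H}(n)\sum_{i=0}^{k-1}A_{-i}(n+i)^*\,\mathcal{H}(n+i)^{-1}\,\delta^i .$$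
   Context: $W$ is a positive definite $M_N(\mathbb{C})$-valued weight function on a (possibly infinite) interval $[a,b]\subset\mathbb{R}$ with finite moments of all orders; $\langle H,G\rangle=\int_a^b H(y)W(y)G(y)^*\,dy$. The monic MVOPs $P(x,n)=x^nI+\cdots$ are the unique monic polynomials with $\langle P(\cdot,n),P(\cdot,m)\rangle=\mathcal{H}(n)\delta_{n,m}$, $\mathcal{H}(n)$ positive definite. They satisfy $xP(x,n)=P(x,n+1)+B(n)P(x,n)+C(n)P(x,n-1)$, $C(0):=0$. Differential operators with rational matrix coefficients act from the right: $F\cdot\sum_j\partial_x^jF_j(x)=\sum_j F^{(j)}(x)F_j(x)$. $\mathcal{D}^\dagger$ is the adjoint of $\mathcal{D}$ with respect to $W$ if $\langle F\cdot\mathcal{D},G\rangle=\langle F,G\cdot\mathcal{D}^\dagger\rangle$ for all matrix valued polynomials $F,G$. Difference operators $M=\sum_{j=-\ell}^{m} A_j(n)\delta^j$ (with $A_j:\mathbb{N}_0\to M_N(\mathbb{C})$) act from the left by $(M\cdot P)(x,n)=\sum_jA_j(n)P(x,n+j)$, with sequences taken to be $0$ at negative integers; coefficients $A_j(n)$ with $n+j<0$ thus play no role and are taken to be $0$. Composition: $(A(n)\delta^i)(B(n)\delta^j)=A(n)B(n+i)\delta^{i+j}$. $\mathcal{F}_L(P)$ is the set of difference operators $M$ for which there is a differential operator $\mathcal{E}$ with rational matrix coefficients, acting from the right, with $M\cdot P=P\cdot\mathcal{E}$. Let $L=\delta+B(n)+C(n)\delta^{-1}$; for a scalar polynomial $q$,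 $(q(L))_j(n)$ is the coefficient of $\delta^j$ in $q(L)$. *)

theory Defs
  imports
    "HOL-Analysis.Analysis"
    "HOL-Computational_Algebra.Computational_Algebra"
    "HOL-Computational_Algebra.Field_as_Ring"
begin

text \<open>
  On the type of matrices \<open>*\<close> and \<open>1\<close> are entrywise. The ring structure of
  $M_N$ is therefore always written with \<open>**\<close> and \<open>mat\<close>.
\<close>

section \<open>Matrices\<close>

definition conj_transpose :: "complex^'n^'m \<Rightarrow> complex^'m^'n" where
  "conj_transpose A = (\<chi> i j. cnj (A $ j $ i))"

definition pos_def :: "complex^'n^'n \<Rightarrow> bool" where
  "pos_def A \<longleftrightarrow> conj_transpose A = A \<and>
     (\<forall>v. v \<noteq> 0 \<longrightarrow> 0 < Re (\<Sum>i\<in>UNIV. \<Sum>j\<in>UNIV. cnj (v $ i) * A $ i $ j * v $ j))"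


section \<open>Matrix valued polynomials and rational functions\<close>

type_synonym 'n mat_poly = "complex poly^'n^'n"
type_synonym 'n mat_rat = "complex poly fract^'n^'n"

definition const_mat :: "complex^'n^'n \<Rightarrow> 'n mat_poly" where
  "const_mat = map_matrix (\<lambda>c. [:c:])"

definition to_rat :: "'n::finite mat_poly \<Rightarrow> 'n mat_rat" where
  "to_rat = map_matrix to_fract"

definition mat_coeff :: "'n mat_poly \<Rightarrow> nat \<Rightarrow> complex^'n^'n" where
  "mat_coeff P k = map_matrix (\<lambda>p. coeff p k) P"

definition monic_of_degree :: "nat \<Rightarrow> 'n::finite mat_poly \<Rightarrow> bool" where
  "monic_of_degree n P \<longleftrightarrow> mat_coeff P n = mat 1 \<and> (\<forall>k>n. mat_coeff P k = 0)"

definition eval_poly :: "'n mat_poly \<Rightarrow> real \<Rightarrow> complex^'n^'n" where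
  "eval_poly P x = map_matrix (\<lambda>p. poly p (of_real x)) P"

text \<open>Evaluation in lowest terms; the value at a pole is \<open>0\<close> by the convention for division.\<close>

definition eval_rat :: "'n mat_rat \<Rightarrow> real \<Rightarrow> complex^'n^'n" where
  "eval_rat R x =
     map_matrix (\<lambda>r. poly (fst (quot_of_fract r)) (of_real x) /
                     poly (snd (quot_of_fract r)) (of_real x)) R"


section \<open>Matrix weights and orthogonal polynomials\<close>

text \<open>
  The endpoints are extended reals, so that the interval may be unbounded. They form a null set:
  positivity is required almost everywhere, and values of the weight there play no role.
  Measurability of the weight is part of the integrability of its zeroth moment.
\<close>

definition matrix_weight :: "ereal \<Rightarrow> ereal \<Rightarrow> (real \<Rightarrow> complex^'n^'n) \<Rightarrow> bool" where
  "matrix_weight a b W \<longleftrightarrow> a < b \<and>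
     (AE x in lborel. x \<in> einterval a b \<longrightarrow> pos_def (W x)) \<and>
     (\<forall>n. interval_lebesgue_integrable lborel a b (\<lambda>x. x ^ n *\<^sub>R W x))"

definition weight_integrand ::
    "(real \<Rightarrow> complex^'n^'n) \<Rightarrow> (real \<Rightarrow> complex^'n^'n) \<Rightarrow> (real \<Rightarrow> complex^'n^'n) \<Rightarrow>
     real \<Rightarrow> complex^'n^'n" where
  "weight_integrand W F G y = F y ** W y ** conj_transpose (G y)"

definition weight_inner ::
    "ereal \<Rightarrow> ereal \<Rightarrow> (real \<Rightarrow> complex^'n^'n) \<Rightarrow>
     (real \<Rightarrow> complex^'n^'n) \<Rightarrow> (real \<Rightarrow> complex^'n^'n) \<Rightarrow> complex^'n^'n" where
  "weight_inner a b W F G = (LBINT y=a..b. weight_integrand W F G y)"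

definition monic_MVOP ::
    "ereal \<Rightarrow> ereal \<Rightarrow> (real \<Rightarrow> complex^'n^'n) \<Rightarrow> (nat \<Rightarrow> 'n mat_poly) \<Rightarrow>
     (nat \<Rightarrow> complex^'n^'n) \<Rightarrow> bool" where
  "monic_MVOP a b W P H \<longleftrightarrow>
     (\<forall>n. monic_of_degree n (P n)) \<and>
     (\<forall>n m. weight_inner a b W (eval_poly (P n)) (eval_poly (P m)) = (if n = m then H n else 0)) \<and>
     (\<forall>n. pos_def (H n))"

text \<open>At \<open>n = 0\<close> the junk term \<open>P (0 - 1) = P 0\<close> is cancelled by \<open>C 0 = 0\<close>.\<close>

definition three_term_recurrence ::
    "(nat \<Rightarrow> 'n mat_poly) \<Rightarrow> (nat \<Rightarrow> complex^'n^'n) \<Rightarrow> (nat \<Rightarrow> complex^'n^'n) \<Rightarrow> bool" where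
  "three_term_recurrence P B C \<longleftrightarrow> C 0 = 0 \<and>
     (\<forall>n. mat [:0, 1:] ** P n =
            P (n + 1) + const_mat (B n) ** P n + const_mat (C n) ** P (n - 1))"


section \<open>Differential operators acting from the right\<close>

text \<open>
  The type \<open>_ poly\<close> serves only as a container for the finitely many coefficients $F_j$ of
  $\sum_j \partial_x^j F_j(x)$; multiplication on it is never used.
\<close>

type_synonym 'n differential_op = "'n mat_rat poly"

definition dact :: "'n::finite mat_poly \<Rightarrow> 'n differential_op \<Rightarrow> 'n mat_rat" where
  "dact F D = (\<Sum>j\<le>degree D. to_rat (map_matrix (pderiv ^^ j) F) ** coeff D j)"

text \<open>
  With rational coefficients the integrals need not exist, hence the integrability clauses.
  For operators with polynomial coefficients these hold automatically.
\<close>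

definition is_adjoint ::
    "ereal \<Rightarrow> ereal \<Rightarrow> (real \<Rightarrow> complex^'n^'n) \<Rightarrow>
     'n differential_op \<Rightarrow> 'n differential_op \<Rightarrow> bool" where
  "is_adjoint a b W D D' \<longleftrightarrow>
     (\<forall>F G.
        interval_lebesgue_integrable lborel a b
          (weight_integrand W (eval_rat (dact F D)) (eval_poly G)) \<and>
        interval_lebesgue_integrable lborel a b
          (weight_integrand W (eval_poly F) (eval_rat (dact G D'))) \<and>
        weight_inner a b W (eval_rat (dact F D)) (eval_poly G) =
        weight_inner a b W (eval_poly F) (eval_rat (dact G D')))"


section \<open>Difference operators acting from the left\<close>

text \<open>\<open>M j n\<close> is the coefficient $A_j(n)$ of $\delta^j$.\<close>

type_synonym 'n difference_op = "int \<Rightarrow> nat \<Rightarrow> complex^'n^'n"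

definition supp :: "'n::finite difference_op \<Rightarrow> int set" where
  "supp M = {j. \<exists>n. M j n \<noteq> 0}"

definition is_difference_op :: "'n::finite difference_op \<Rightarrow> bool" where
  "is_difference_op M \<longleftrightarrow> finite (supp M) \<and> (\<forall>j n. int n + j < 0 \<longrightarrow> M j n = 0)"

definition difference_act ::
    "'n::finite difference_op \<Rightarrow> (nat \<Rightarrow> 'n mat_poly) \<Rightarrow> nat \<Rightarrow> 'n mat_poly" where
  "difference_act M P n =
     (\<Sum>j\<in>supp M. if 0 \<le> int n + j then const_mat (M j n) ** P (nat (int n + j)) else 0)"

definition difference_comp ::
    "'n::finite difference_op \<Rightarrow> 'n difference_op \<Rightarrow> 'n difference_op" where
  "difference_comp M M' = (\<lambda>k n.
     \<Sum>i\<in>supp M. if 0 \<le> int n + i then M i n ** M' (k - i) (nat (int n + i)) else 0)"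

definition difference_id :: "'n::finite difference_op" where
  "difference_id = (\<lambda>j n. if j = 0 then mat 1 else 0)"

definition difference_poly :: "complex poly \<Rightarrow> 'n::finite difference_op \<Rightarrow> 'n difference_op" where
  "difference_poly q L = (\<lambda>j n.
     \<Sum>m\<le>degree q. mat (coeff q m) ** (difference_comp L ^^ m) difference_id j n)"

definition recurrence_op ::
    "(nat \<Rightarrow> complex^'n^'n) \<Rightarrow> (nat \<Rightarrow> complex^'n^'n) \<Rightarrow> 'n difference_op" where
  "recurrence_op B C = (\<lambda>j n.
     if j = 1 then mat 1 else if j = 0 then B n else if j = -1 then C n else 0)"

definition intertwines ::
    "(nat \<Rightarrow> 'n::finite mat_poly) \<Rightarrow> 'n difference_op \<Rightarrow> 'n differential_op \<Rightarrow> bool" where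
  "intertwines P M E \<longleftrightarrow> (\<forall>n. to_rat (difference_act M P n) = dact (P n) E)"

text \<open>The left Fourier algebra $\mathcal{F}_L(P)$.\<close>

definition fourier_left :: "(nat \<Rightarrow> 'n::finite mat_poly) \<Rightarrow> 'n difference_op set" where
  "fourier_left P = {M. is_difference_op M \<and> (\<exists>E. intertwines P M E)}"

end

theory Submission
  imports Defs
begin

text \<open>
  Write $\langle F, G\rangle$ for the form of the weight on matrix valued polynomials. The
  polynomials $P(x,m)$ are monic of degree $m$ and the norms $H(m)$ are invertible, so $F$ is
  determined by the matrices $\langle F, P_m\rangle$ (\<open>eq_0_if_ip_P_eq_0\<close>), and
  orthogonality gives $\langle (M\cdot P)_n, P_m\rangle = M_{m-n}(n) H(m)$
  (\<open>ip_difference_act\<close>). Hence a difference operator is determined by its action on $P$, and an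
  intertwining relation $M\cdot P = P\cdot E$ amounts to the computation of all matrices
  $\langle P_n\cdot E, P_m\rangle$.

  For $D = \partial_x + A$ these vanish for $m > n$, because $D$ does not raise degrees, and for
  $m = n$ the leading coefficient contributes $A H(n)$. For $m < n$ the operator moves to the other
  side as $-D + v'$, where $P_m\cdot D$ is orthogonal to $P_n$ for reasons of degree. What remains
  is $\langle P_n, v' P_m\rangle$. Although the coefficients of $v$ are complex, multiplication by
  $v'$ is symmetric: applying the adjoint relation twice, in both orders of the arguments, yields
  this from the Hermitian symmetry of the form (\<open>symmetric_if_adjoint\<close>). So one gets
  $\langle v' P_n, P_m\rangle$, which the three term recurrence identifies with
  $(v'(L))_{m-n}(n) H(m)$ (\<open>ip_mat_mult_P\<close>); and the symmetric form shows that it vanishes as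
  soon as $m + \deg v' < n$. This is \<open>ip_deriv_plus_P\<close>.

  For the adjoint, $\langle P_n\cdot D^\dagger, P_m\rangle$ is the conjugate transpose of
  $\langle P_m\cdot D, P_n\rangle$, that is, $H(n) M_{n-m}(m)^*$. Dividing by $H(m)$ on the right
  gives the stated formula (\<open>ip_adjoint_P\<close>).

  A constant $v$ has to be excluded, since then $M$ would have no coefficients at all, not even
  $A_0 = A$. In that case $P_1\cdot D = A P_1$, and the constant coefficients give
  $p A + I = A p$ with $p = P_1(0)$, which contradicts the trace
  (\<open>adjoint_deriv_plus_nonzero\<close>).
\<close>

(* Leaves \<open>$\<close> to the components of vectors. *)
no_notation fps_nth (infixl "$" 75)


section \<open>Square matrices\<close>

lemma matrix_add_mult_distrib:
  fixes X Y :: "'a::semiring_1^'n^'m"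
  shows "(X + Y) ** Z = X ** Z + Y ** Z"
  by (simp add: matrix_matrix_mult_def vec_eq_iff sum.distrib distrib_right)

lemma matrix_mult_diff_distrib:
  fixes X :: "'a::ring_1^'n^'m"
  shows "X ** (Y - Z) = X ** Y - X ** Z"
  by (simp add: matrix_matrix_mult_def vec_eq_iff sum_subtractf right_diff_distrib)

lemma matrix_sum_mult_distrib:
  fixes X :: "'b \<Rightarrow> 'a::semiring_1^'n^'m"
  shows "(\<Sum>i\<in>S. X i) ** Z = (\<Sum>i\<in>S. X i ** Z)"
  by (induction S rule: infinite_finite_induct) (simp_all add: matrix_add_mult_distrib)

lemma matrix_mult_sum_distrib:
  fixes X :: "'a::semiring_1^'n^'m"
  shows "X ** (\<Sum>i\<in>S. Z i) = (\<Sum>i\<in>S. X ** Z i)"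
  by (induction S rule: infinite_finite_induct) (simp_all add: matrix_add_ldistrib)

lemma mat_mult_nth:
  fixes X :: "'a::semiring_1^'n^'m"
  shows "(mat q ** X) $ i $ j = q * X $ i $ j"
  by (simp add: matrix_matrix_mult_def mat_def if_distrib if_distribR cong: if_cong)

lemma mult_mat_nth:
  fixes X :: "'a::comm_semiring_1^'n^'m"
  shows "(X ** mat q) $ i $ j = q * X $ i $ j"
  by (simp add: matrix_matrix_mult_def mat_def if_distrib if_distribR mult.commute cong: if_cong)

lemma mat_commute:
  fixes X :: "'a::comm_semiring_1^'n^'m"
  shows "X ** mat q = mat q ** X"
  by (simp add: vec_eq_iff mat_mult_nth mult_mat_nth)

lemma mat_mult_swap:
  fixes X :: "'a::comm_semiring_1^'n^'m"
  shows "mat q ** (X ** Y) = X ** (mat q ** Y)"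
  by (simp add: matrix_mul_assoc mat_commute)

lemma mat_mult: "mat (p * q) = mat p ** (mat q :: 'a::semiring_1^'n^'n)"
  by (simp add: vec_eq_iff mat_mult_nth) (simp add: mat_def)

lemma mat_sum: "mat (\<Sum>i\<in>S. f i) = (\<Sum>i\<in>S. mat (f i) :: 'a::semiring_1^'n^'n)"
  by (induction S rule: infinite_finite_induct) (simp_all add: vec_eq_iff mat_def)

lemma conj_transpose_mult: "conj_transpose (X ** Y) = conj_transpose Y ** conj_transpose X"
  by (simp add: conj_transpose_def matrix_matrix_mult_def vec_eq_iff mult.commute)

lemma conj_transpose_add: "conj_transpose (X + Y) = conj_transpose X + conj_transpose Y"
  by (simp add: conj_transpose_def vec_eq_iff)

lemma conj_transpose_diff: "conj_transpose (X - Y) = conj_transpose X - conj_transpose Y"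
  by (simp add: conj_transpose_def vec_eq_iff)

lemma conj_transpose_zero [simp]: "conj_transpose 0 = 0"
  by (simp add: conj_transpose_def vec_eq_iff)

lemma conj_transpose_sum: "conj_transpose (\<Sum>i\<in>S. X i) = (\<Sum>i\<in>S. conj_transpose (X i))"
  by (induction S rule: infinite_finite_induct) (simp_all add: conj_transpose_add)

lemma conj_transpose_scaleR: "conj_transpose (c *\<^sub>R X) = c *\<^sub>R conj_transpose X"
  by (simp add: conj_transpose_def vec_eq_iff)

lemma conj_transpose_conj_transpose [simp]: "conj_transpose (conj_transpose X) = X"
  by (simp add: conj_transpose_def vec_eq_iff)

lemma pos_def_invertible:
  assumes "pos_def X"
  shows "invertible X"
proof -
  have "x = 0" if "X *v x = 0" for x
  proof (rule ccontr)
    assume "x \<noteq> 0"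
    then have "0 < Re (\<Sum>i\<in>UNIV. \<Sum>j\<in>UNIV. cnj (x $ i) * X $ i $ j * x $ j)"
      using assms unfolding pos_def_def by blast
    moreover have "(\<Sum>i\<in>UNIV. \<Sum>j\<in>UNIV. cnj (x $ i) * X $ i $ j * x $ j)
        = (\<Sum>i\<in>UNIV. cnj (x $ i) * (X *v x) $ i)"
      by (simp add: matrix_vector_mult_def sum_distrib_left mult.assoc)
    ultimately show False
      using that by simp
  qed
  then show ?thesis
    by (metis invertible_def matrix_left_invertible_ker matrix_left_right_inverse)
qed

lemma matrix_inv_mult:
  fixes X :: "'a::semiring_1^'n^'n"
  assumes "invertible X"
  shows "matrix_inv X ** X = mat 1"
  using assms unfolding invertible_def matrix_inv_def by (metis (mono_tags, lifting) someI_ex)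

lemma invertible_mult_right_cancel:
  fixes X Y Z :: "'a::semiring_1^'n^'n"
  assumes "invertible Z" "X ** Z = Y ** Z"
  shows "X = Y"
  using assms unfolding invertible_def by (metis matrix_mul_assoc matrix_mul_rid)


section \<open>Coefficients of matrix valued polynomials\<close>

lemma const_mat_mat: "const_mat (mat c) = mat [:c:]"
  by (simp add: const_mat_def mat_def vec_eq_iff)

lemma mat_coeff_eqI: "(\<And>k. mat_coeff F k = mat_coeff G k) \<Longrightarrow> F = G"
  by (simp add: mat_coeff_def vec_eq_iff poly_eq_iff)

lemma mat_coeff_zero [simp]: "mat_coeff 0 k = 0"
  by (simp add: mat_coeff_def vec_eq_iff)

lemma mat_coeff_add: "mat_coeff (F + G) k = mat_coeff F k + mat_coeff G k"
  by (simp add: mat_coeff_def vec_eq_iff)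

lemma mat_coeff_diff: "mat_coeff (F - G) k = mat_coeff F k - mat_coeff G k"
  by (simp add: mat_coeff_def vec_eq_iff)

lemma mat_coeff_const_mult: "mat_coeff (const_mat c ** F) k = c ** mat_coeff F k"
  by (simp add: mat_coeff_def const_mat_def matrix_matrix_mult_def vec_eq_iff coeff_sum)

lemma mat_coeff_mult_const: "mat_coeff (F ** const_mat c) k = mat_coeff F k ** c"
  by (simp add: mat_coeff_def const_mat_def matrix_matrix_mult_def vec_eq_iff coeff_sum mult.commute)

lemma mat_coeff_pderiv:
  "mat_coeff (map_matrix pderiv F) k = real (Suc k) *\<^sub>R mat_coeff F (Suc k)"
  by (simp add: mat_coeff_def vec_eq_iff coeff_pderiv scaleR_conv_of_real[where 'a = complex])

definition degree_below :: "nat \<Rightarrow> 'n::finite mat_poly \<Rightarrow> bool" where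
  "degree_below d F \<longleftrightarrow> (\<forall>k\<ge>d. mat_coeff F k = 0)"

lemma degree_below_0: "degree_below 0 F \<longleftrightarrow> F = 0"
proof
  assume "degree_below 0 F"
  then show "F = 0"
    by (intro mat_coeff_eqI) (simp add: degree_below_def mat_coeff_def vec_eq_iff)
qed (simp add: degree_below_def mat_coeff_def vec_eq_iff)

lemma degree_below_Suc:
  "degree_below (Suc d) F \<Longrightarrow> mat_coeff F d = 0 \<Longrightarrow> degree_below d F"
  unfolding degree_below_def by (metis le_eq_less_or_eq Suc_leI)

lemma degree_below_mono: "degree_below d F \<Longrightarrow> d \<le> d' \<Longrightarrow> degree_below d' F"
  by (auto simp: degree_below_def)

lemma degree_below_diff: "degree_below d F \<Longrightarrow> degree_below d G \<Longrightarrow> degree_below d (F - G)"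
  by (simp add: degree_below_def mat_coeff_diff)

lemma degree_below_const_mult: "degree_below d F \<Longrightarrow> degree_below d (const_mat c ** F)"
  by (simp add: degree_below_def mat_coeff_const_mult)

lemma ex_degree_below: "\<exists>d. degree_below d F"
proof
  let ?d = "Suc (\<Sum>i\<in>UNIV. \<Sum>j\<in>UNIV. degree (F $ i $ j))"
  have "degree (F $ i $ j) < ?d" for i j
  proof -
    have "degree (F $ i $ j) \<le> (\<Sum>j\<in>UNIV. degree (F $ i $ j))"
      by (rule member_le_sum) auto
    also have "\<dots> \<le> (\<Sum>i\<in>UNIV. \<Sum>j\<in>UNIV. degree (F $ i $ j))"
      by (rule member_le_sum[of _ _ "\<lambda>i. \<Sum>j\<in>UNIV. degree (F $ i $ j)"]) auto
    finally show ?thesis by simp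
  qed
  then have "coeff (F $ i $ j) k = 0" if "?d \<le> k" for i j k
    using that by (intro coeff_eq_0) (rule less_le_trans)
  then show "degree_below ?d F"
    by (simp add: degree_below_def mat_coeff_def vec_eq_iff)
qed

lemma degree_below_mat_mult:
  assumes "degree_below d F"
  shows "degree_below (degree q + d) (mat q ** F)"
proof -
  have "coeff (q * F $ i $ j) k = 0" if "degree q + d \<le> k" for i j k
  proof (cases d)
    case 0
    then show ?thesis using assms by (simp add: degree_below_0)
  next
    case (Suc e)
    have "coeff (F $ i $ j) l = 0" if "l > e" for l
      using assms that Suc by (auto simp: degree_below_def mat_coeff_def vec_eq_iff)
    then have "degree (F $ i $ j) \<le> e" by (simp add: degree_le)
    then have "degree (q * F $ i $ j) < k"
      using degree_mult_le[of q "F $ i $ j"] that Suc by linarith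
    then show ?thesis by (rule coeff_eq_0)
  qed
  then show ?thesis
    by (simp add: degree_below_def mat_coeff_def vec_eq_iff mat_mult_nth)
qed

lemma mat_poly_eq_sum:
  fixes F :: "complex poly^'n^'n"
  shows "mat q ** F = (\<Sum>r\<le>degree q. const_mat (mat (coeff q r)) ** (mat ([:0, 1:] ^ r) ** F))"
proof -
  have "mat q = (\<Sum>r\<le>degree q. const_mat (mat (coeff q r)) ** mat ([:0, 1:] ^ r) :: complex poly^'n^'n)"
    by (simp add: const_mat_mat flip: mat_mult mat_sum)
      (simp flip: monom_altdef add: poly_as_sum_of_monoms)
  then show ?thesis
    by (simp add: matrix_sum_mult_distrib matrix_mul_assoc)
qed


section \<open>Composition with the recurrence operator\<close>

text \<open>
  The truncated \<open>n - 1\<close> at \<open>n = 0\<close> is harmless because of the factor \<open>C 0\<close>.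
\<close>

lemma difference_comp_recurrence_op:
  assumes "C 0 = 0"
  shows "difference_comp (recurrence_op B C) X k n
    = X (k - 1) (Suc n) + B n ** X k n + C n ** X (k + 1) (n - 1)"
proof -
  let ?L = "recurrence_op B C"
  have "supp ?L \<subseteq> {-1, 0, 1}"
    by (auto simp: supp_def recurrence_op_def)
  then have "difference_comp ?L X k n
      = (\<Sum>i\<in>{-1, 0, 1}. if 0 \<le> int n + i then ?L i n ** X (k - i) (nat (int n + i)) else 0)"
    unfolding difference_comp_def by (intro sum.mono_neutral_left) (auto simp: supp_def)
  then show ?thesis
    using assms by (cases n) (simp_all add: recurrence_op_def nat_add_distrib ac_simps)
qed


section \<open>Hermitian forms with orthogonal monic polynomials\<close>

text \<open>
  The integral enters the algebra only through these laws; \<open>hermitian_form_weight_inner\<close> below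
  establishes them for a matrix weight.
\<close>

locale hermitian_form =
  fixes ip :: "'n::finite mat_poly \<Rightarrow> 'n mat_poly \<Rightarrow> complex^'n^'n"
  assumes ip_add: "ip (F + G) K = ip F K + ip G K"
    and ip_const_mult: "ip (const_mat c ** F) G = c ** ip F G"
    and ip_conj: "conj_transpose (ip F G) = ip G F"
begin

lemma ip_zero: "ip 0 K = 0"
  using ip_add[of 0 0 K] by simp

lemma ip_diff: "ip (F - G) K = ip F K - ip G K"
  using ip_add[of "F - G" G K] by simp

lemma ip_sum: "ip (\<Sum>i\<in>S. F i) K = (\<Sum>i\<in>S. ip (F i) K)"
  by (induction S rule: infinite_finite_induct) (simp_all add: ip_add ip_zero)

lemma ip_diff_right: "ip K (F - G) = ip K F - ip K G"
  by (metis conj_transpose_diff ip_conj ip_diff)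

end

locale monic_orthogonal_polynomials = hermitian_form ip
  for ip :: "'n::finite mat_poly \<Rightarrow> 'n mat_poly \<Rightarrow> complex^'n^'n" +
  fixes P :: "nat \<Rightarrow> 'n mat_poly" and H :: "nat \<Rightarrow> complex^'n^'n"
  assumes monic: "monic_of_degree n (P n)"
    and orthogonal: "ip (P n) (P m) = (if n = m then H n else 0)"
    and invertible_H: "invertible (H n)"
begin

lemma degree_below_P: "degree_below (Suc n) (P n)"
  using monic[of n] by (simp add: monic_of_degree_def degree_below_def)

lemma conj_transpose_H: "conj_transpose (H n) = H n"
  using ip_conj[of "P n" "P n"] by (simp add: orthogonal)

text \<open>
  The bound \<open>d \<le> Suc m\<close> allows \<open>m\<close> to be the degree of \<open>F\<close>, where the leading coefficient
  appears, or larger, where the right side is zero. Subtracting the leading coefficient times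
  \<open>P d\<close> lowers the degree and, for \<open>m > d\<close>, does not change the left side.
\<close>

lemma ip_P_leading:
  assumes "degree_below d F" "d \<le> Suc m"
  shows "ip F (P m) = mat_coeff F m ** H m"
  using assms
proof (induction d arbitrary: F m)
  case 0
  then show ?case by (simp add: degree_below_0 ip_zero)
next
  case (Suc d)
  define G where "G = F - const_mat (mat_coeff F d) ** P d"
  have "mat_coeff (P d) d = mat 1"
    using monic[of d] by (simp add: monic_of_degree_def)
  then have G: "degree_below d G"
    unfolding G_def using Suc.prems degree_below_P[of d]
    by (intro degree_below_Suc[OF degree_below_diff] degree_below_const_mult)
      (simp_all add: mat_coeff_diff mat_coeff_const_mult)
  have "ip G (P m) = 0"
    using Suc.IH[OF G] Suc.prems G by (simp add: degree_below_def)
  then have "ip F (P m) = mat_coeff F d ** (if d = m then H d else 0)"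
    by (simp add: G_def ip_diff ip_const_mult orthogonal)
  then show ?case
    using Suc.prems by (auto simp: degree_below_def)
qed

lemma ip_P_eq_0: "degree_below m F \<Longrightarrow> ip F (P m) = 0"
  using ip_P_leading[of m F m] by (simp add: degree_below_def)

lemma ip_P_eq_0_right: "degree_below m F \<Longrightarrow> ip (P m) F = 0"
  by (metis conj_transpose_zero ip_P_eq_0 ip_conj)

text \<open>
  Nondegeneracy of the form: by \<open>ip_P_leading\<close>, orthogonality to \<open>P d\<close> removes the leading
  coefficient of a polynomial of degree \<open>d\<close>.
\<close>

lemma eq_0_if_ip_P_eq_0:
  assumes "\<And>m. ip F (P m) = 0"
  shows "F = 0"
proof -
  have "degree_below d F \<Longrightarrow> F = 0" for d
  proof (induction d)
    case (Suc d)
    have "mat_coeff F d ** H d = 0 ** H d"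
      using ip_P_leading[OF Suc.prems] assms by simp
    then show ?case
      using invertible_H invertible_mult_right_cancel Suc by (blast intro: degree_below_Suc)
  qed (simp add: degree_below_0)
  then show ?thesis using ex_degree_below by blast
qed

lemma ip_difference_act:
  assumes "finite (supp M)"
  shows "ip (difference_act M P n) (P m) = M (int m - int n) n ** H m"
proof -
  have "ip (difference_act M P n) (P m)
      = (\<Sum>j\<in>supp M. if j = int m - int n then M j n ** H m else 0)"
    unfolding difference_act_def ip_sum
    by (rule sum.cong) (auto simp: ip_const_mult orthogonal ip_zero)
  also have "\<dots> = M (int m - int n) n ** H m"
    using assms by (auto simp: supp_def)
  finally show ?thesis .
qed

lemma difference_act_eqI:
  assumes "finite (supp M)" "\<And>m. ip F (P m) = M (int m - int n) n ** H m"
  shows "difference_act M P n = F"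
  using eq_0_if_ip_P_eq_0[of "difference_act M P n - F"] assms
  by (simp add: ip_diff ip_difference_act)

lemma difference_act_inject:
  assumes "is_difference_op M" "is_difference_op M'"
    and "\<And>n. difference_act M P n = difference_act M' P n"
  shows "M = M'"
proof (intro ext)
  fix j n
  show "M j n = M' j n"
  proof (cases "int n + j < 0")
    case True
    then show ?thesis using assms(1,2) by (simp add: is_difference_op_def)
  next
    case False
    define m where "m = nat (int n + j)"
    have j: "int m - int n = j" using False by (simp add: m_def)
    have "M j n ** H m = M' j n ** H m"
      using ip_difference_act[of M n m] ip_difference_act[of M' n m] assms j
      by (simp add: is_difference_op_def)
    then show ?thesis by (rule invertible_mult_right_cancel[OF invertible_H])
  qed
qed

text \<open>
  The coefficients of $L^r$ are the Fourier coefficients of $x^r P_n$. Comparing inner products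
  instead of expansions avoids any statement about the support of the powers of \<open>L\<close>.
\<close>

lemma ip_power_mult_P:
  assumes "three_term_recurrence P B C"
  shows "ip (mat ([:0, 1:] ^ r) ** P n) (P m)
    = (difference_comp (recurrence_op B C) ^^ r) difference_id (int m - int n) n ** H m"
proof (induction r arbitrary: n)
  case 0
  then show ?case by (auto simp: orthogonal difference_id_def)
next
  case (Suc r)
  let ?x = "mat ([:0, 1:] ^ r) :: 'n mat_poly"
  have C0: "C 0 = 0" using assms by (simp add: three_term_recurrence_def)
  have "mat ([:0, 1:] ^ Suc r) ** P n = ?x ** (mat [:0, 1:] ** P n)"
    by (simp only: power_Suc2 mat_mult matrix_mul_assoc)
  also have "\<dots> = ?x ** P (Suc n) + const_mat (B n) ** (?x ** P n)
      + const_mat (C n) ** (?x ** P (n - 1))"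
    using assms by (simp add: three_term_recurrence_def matrix_add_ldistrib mat_mult_swap)
  finally have "ip (mat ([:0, 1:] ^ Suc r) ** P n) (P m)
      = ip (?x ** P (Suc n)) (P m) + B n ** ip (?x ** P n) (P m)
        + C n ** ip (?x ** P (n - 1)) (P m)"
    by (simp only: ip_add ip_const_mult)
  also have "\<dots> = difference_comp (recurrence_op B C)
      ((difference_comp (recurrence_op B C) ^^ r) difference_id) (int m - int n) n ** H m"
    unfolding difference_comp_recurrence_op[of C, OF C0] Suc.IH
    using C0 by (cases n) (simp_all add: matrix_add_mult_distrib matrix_mul_assoc algebra_simps)
  finally show ?case by simp
qed

lemma ip_mat_mult_P:
  assumes "three_term_recurrence P B C"
  shows "ip (mat q ** P n) (P m)
    = difference_poly q (recurrence_op B C) (int m - int n) n ** H m"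
  unfolding mat_poly_eq_sum[of q] difference_poly_def
  by (simp add: ip_sum ip_const_mult ip_power_mult_P[OF assms] matrix_sum_mult_distrib
      flip: matrix_mul_assoc)

end


section \<open>The operator $\partial_x + A$\<close>

text \<open>
  The right action of $\partial_x + A$ on polynomials, without the passage to rational matrices.
\<close>

definition deriv_plus :: "complex^'n^'n \<Rightarrow> 'n::finite mat_poly \<Rightarrow> 'n mat_poly" where
  "deriv_plus A F = F ** const_mat A + map_matrix pderiv F"

lemma mat_coeff_deriv_plus:
  "mat_coeff (deriv_plus A F) k = mat_coeff F k ** A + real (Suc k) *\<^sub>R mat_coeff F (Suc k)"
  by (simp only: deriv_plus_def mat_coeff_add mat_coeff_mult_const mat_coeff_pderiv)

lemma degree_below_deriv_plus: "degree_below d F \<Longrightarrow> degree_below d (deriv_plus A F)"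
  by (simp add: degree_below_def mat_coeff_deriv_plus del: of_nat_Suc)

text \<open>
  If $T^\dagger = w - T$, then also $T = (T^\dagger)^\dagger = w^\dagger - T^\dagger
  = w^\dagger - w + T$, so $w^\dagger = w$.
\<close>

lemma (in hermitian_form) symmetric_if_adjoint:
  assumes adjoint: "\<And>F G. ip (T F) G = ip F (mat w ** G - T G)"
  shows "ip (mat w ** F) G = ip F (mat w ** G)"
proof -
  have "ip F (T G) = conj_transpose (ip (T G) F)"
    by (simp add: ip_conj)
  also have "\<dots> = ip (mat w ** F) G - ip (T F) G"
    by (simp add: adjoint[of G] ip_conj ip_diff)
  finally show ?thesis
    using adjoint[of F G] by (simp add: ip_diff_right)
qed

context monic_orthogonal_polynomials
begin

lemma ip_deriv_plus_P_below:
  assumes "\<And>F G. ip (deriv_plus A F) G = ip F (mat w ** G - deriv_plus A G)" "m < n"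
  shows "ip (deriv_plus A (P n)) (P m) = ip (mat w ** P n) (P m)"
proof -
  have "degree_below n (P m)"
    using \<open>m < n\<close> by (intro degree_below_mono[OF degree_below_P]) simp
  then have "ip (P n) (deriv_plus A (P m)) = 0"
    by (intro ip_P_eq_0_right degree_below_deriv_plus)
  then show ?thesis
    by (simp add: assms(1) ip_diff_right symmetric_if_adjoint[of "deriv_plus A" w])
qed

text \<open>
  If $\partial_x + A$ were skew adjoint, $P_1\cdot(\partial_x + A)$ would be orthogonal to $P_0$ and
  hence equal to $A P_1$; with $p = P_1(0)$ the constant coefficients yield $I = A p - p A$, and
  the identity is not a commutator in characteristic zero.
\<close>

lemma adjoint_deriv_plus_nonzero:
  assumes "\<And>F G. ip (deriv_plus A F) G = ip F (mat w ** G - deriv_plus A G)"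
  shows "w \<noteq> 0"
proof
  assume "w = 0"
  define p where "p = mat_coeff (P 1) 0"
  define F where "F = deriv_plus A (P 1) - const_mat A ** P 1"
  have P1: "mat_coeff (P 1) (Suc 0) = mat 1" and P2: "mat_coeff (P 1) (Suc (Suc 0)) = 0"
    using monic[of 1] by (simp_all add: monic_of_degree_def)
  have "degree_below 1 F"
    unfolding One_nat_def F_def using degree_below_P[of 1] P1 P2
    by (intro degree_below_Suc[OF degree_below_diff] degree_below_deriv_plus degree_below_const_mult)
      (simp_all add: mat_coeff_diff mat_coeff_deriv_plus mat_coeff_const_mult)
  then have "mat_coeff F 0 ** H 0 = ip F (P 0)"
    by (simp add: ip_P_leading)
  also have "\<dots> = 0 ** H 0"
    using ip_deriv_plus_P_below[of A w 0 1, OF assms] \<open>w = 0\<close>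
    by (simp add: F_def ip_diff ip_const_mult orthogonal ip_zero)
  finally have "mat_coeff F 0 = 0"
    using invertible_H invertible_mult_right_cancel by blast
  then have "p ** A + mat 1 = A ** p"
    using P1 by (simp add: F_def mat_coeff_diff mat_coeff_deriv_plus mat_coeff_const_mult p_def)
  then have "trace (p ** A + mat 1) = trace (A ** p)" by (rule arg_cong)
  then show False
    by (simp add: trace_add trace_I trace_mul_sym[of A p])
qed

text \<open>
  Below the diagonal the coefficients are those of $w(L)$, and they are cut off at
  $j = -\deg w$ because $\langle w P_n, P_m\rangle = \langle P_n, w P_m\rangle$ is zero when
  $w P_m$ has degree less than $n$.
\<close>

lemma ip_deriv_plus_P:
  assumes recurrence: "three_term_recurrence P B C"
    and adjoint: "\<And>F G. ip (deriv_plus A F) G = ip F (mat w ** G - deriv_plus A G)"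
    and M: "M = (\<lambda>j n. if - int (degree w) \<le> j \<and> j \<le> 0
                  then (if j = 0 then A else difference_poly w (recurrence_op B C) j n)
                  else 0)"
  shows "ip (deriv_plus A (P n)) (P m) = M (int m - int n) n ** H m"
proof (cases "m < n")
  case True
  show ?thesis
  proof (cases "degree w + m < n")
    case True
    have "degree_below n (mat w ** P m)"
      using True by (intro degree_below_mono[OF degree_below_mat_mult[OF degree_below_P]]) simp
    then have "ip (mat w ** P n) (P m) = 0"
      by (simp add: symmetric_if_adjoint[OF adjoint] ip_P_eq_0_right)
    then show ?thesis
      using True \<open>m < n\<close> by (simp add: M ip_deriv_plus_P_below[OF adjoint])
  next
    case False
    then show ?thesis
      using \<open>m < n\<close> by (simp add: M ip_deriv_plus_P_below[OF adjoint] ip_mat_mult_P[OF recurrence])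
  qed
next
  case False
  then have "ip (deriv_plus A (P n)) (P m) = mat_coeff (deriv_plus A (P n)) m ** H m"
    using degree_below_deriv_plus[OF degree_below_P] by (intro ip_P_leading) auto
  also have "mat_coeff (deriv_plus A (P n)) m = (if m = n then A else 0)"
    using False monic[of n] by (auto simp: mat_coeff_deriv_plus monic_of_degree_def)
  finally show ?thesis using False by (simp add: M)
qed

text \<open>
  Conjugate transposition turns the matrix $(\langle P_m\cdot T, P_n\rangle)$ into
  $(\langle P_n\cdot T^\dagger, P_m\rangle)$. This is the origin of the reflected index \<open>- i\<close>, of
  the shifted argument \<open>n + nat i\<close> and of the two factors \<open>H\<close>.
\<close>

lemma ip_adjoint_P:
  assumes adjoint: "\<And>F G. ip (T F) G = ip F (T' G)"
    and T: "\<And>n m. ip (T (P n)) (P m) = M (int m - int n) n ** H m"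
    and M: "\<And>j n. \<not> (- int l \<le> j \<and> j \<le> 0) \<Longrightarrow> M j n = 0"
    and M': "M' = (\<lambda>i n. if 0 \<le> i \<and> i \<le> int l
               then H n ** conj_transpose (M (- i) (n + nat i)) ** matrix_inv (H (n + nat i))
               else 0)"
  shows "ip (T' (P n)) (P m) = M' (int m - int n) n ** H m"
proof -
  have "ip (T' (P n)) (P m) = conj_transpose (ip (T (P m)) (P n))"
    by (simp add: adjoint ip_conj)
  also have "\<dots> = H n ** conj_transpose (M (int n - int m) m)"
    by (simp add: T conj_transpose_mult conj_transpose_H)
  also have "\<dots> = M' (int m - int n) n ** H m"
  proof (cases "n \<le> m \<and> m \<le> n + l")
    case True
    then have "n + nat (int m - int n) = m" by linarith
    then have "M' (int m - int n) n
        = H n ** conj_transpose (M (int n - int m) m) ** matrix_inv (H m)"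
      using True by (simp add: M')
    then show ?thesis
      by (simp add: matrix_inv_mult[OF invertible_H] flip: matrix_mul_assoc)
  next
    case False
    then have "M (int n - int m) m = 0" by (intro M) linarith
    then show ?thesis using False by (auto simp: M')
  qed
  finally show ?thesis .
qed

end


section \<open>Embedding into rational matrices\<close>

lemma to_rat_add: "to_rat (F + G) = to_rat F + to_rat G"
  by (simp add: to_rat_def vec_eq_iff)

lemma to_rat_diff: "to_rat (F - G) = to_rat F - to_rat G"
  by (simp add: to_rat_def vec_eq_iff)

lemma to_rat_mult: "to_rat (F ** G) = to_rat F ** to_rat G"
  by (simp add: to_rat_def matrix_matrix_mult_def vec_eq_iff)

lemma to_rat_eq_iff: "to_rat F = to_rat G \<longleftrightarrow> F = G"
  by (simp add: to_rat_def vec_eq_iff)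

lemma eval_rat_to_rat: "eval_rat (to_rat F) = eval_poly F"
  by (simp add: fun_eq_iff eval_rat_def eval_poly_def to_rat_def vec_eq_iff)

lemma dact_degree_le_1:
  "dact F [:X, Y:] = to_rat F ** X + to_rat (map_matrix pderiv F) ** Y"
proof -
  have "map_matrix id F = F" by (simp add: vec_eq_iff)
  then show ?thesis
    by (cases "Y = 0") (simp_all add: dact_def o_def)
qed

lemma dact_deriv_plus: "dact F [:to_rat (const_mat A), mat 1:] = to_rat (deriv_plus A F)"
  by (simp add: dact_degree_le_1 deriv_plus_def to_rat_add to_rat_mult)

lemma dact_adjoint_deriv_plus:
  fixes F :: "'n::finite mat_poly"
  shows "dact F (- [:to_rat (const_mat A), mat 1:] + [:to_rat (mat w):])
    = to_rat (mat w ** F - deriv_plus A F)"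
proof -
  have "X ** - mat 1 = - X" for X :: "'n mat_rat"
    using matrix_mult_diff_distrib[of X 0 "mat 1"] by simp
  moreover have "X ** (- Y + Z) = X ** Z - X ** Y" for X Y Z :: "'n mat_rat"
    using matrix_mult_diff_distrib[of X Z Y] by simp
  moreover have "to_rat (mat w ** F) = to_rat F ** to_rat (mat w)"
    by (simp only: to_rat_mult[symmetric] mat_commute)
  ultimately show ?thesis
    by (simp add: dact_degree_le_1 deriv_plus_def to_rat_add to_rat_diff to_rat_mult[of F])
qed


section \<open>The form of a matrix weight\<close>

lemma eval_poly_add: "eval_poly (F + G) x = eval_poly F x + eval_poly G x"
  by (simp add: eval_poly_def vec_eq_iff)

lemma eval_poly_const_mult: "eval_poly (const_mat c ** F) x = c ** eval_poly F x"
  by (simp add: eval_poly_def const_mat_def matrix_matrix_mult_def vec_eq_iff poly_sum)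

lemma eval_poly_eq_sum:
  assumes "degree_below d F"
  shows "eval_poly F x = (\<Sum>r<d. x ^ r *\<^sub>R mat_coeff F r)"
proof -
  have "poly (F $ i $ j) (of_real x) = (\<Sum>r<d. x ^ r *\<^sub>R coeff (F $ i $ j) r)" for i j
  proof -
    have "coeff (F $ i $ j) r = 0" if "d \<le> r" for r
      using assms that by (simp add: degree_below_def mat_coeff_def vec_eq_iff)
    then have "(\<Sum>r<d. coeff (F $ i $ j) r * of_real x ^ r)
        = (\<Sum>r\<le>degree (F $ i $ j). coeff (F $ i $ j) r * of_real x ^ r)"
      by (intro sum.mono_neutral_cong) (auto simp: coeff_eq_0 not_less not_le)
    then show ?thesis
      by (simp add: poly_altdef scaleR_conv_of_real[where 'a = complex] mult.commute)
  qed
  then show ?thesis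
    by (simp add: eval_poly_def mat_coeff_def vec_eq_iff sum_component)
qed

lemma interval_lebesgue_integrable_bounded_linear:
  fixes f :: "real \<Rightarrow> 'a::{banach, second_countable_topology}"
    and T :: "'a \<Rightarrow> 'b::{banach, second_countable_topology}"
  assumes "bounded_linear T" "interval_lebesgue_integrable M a b f"
  shows "interval_lebesgue_integrable M a b (\<lambda>x. T (f x))"
proof -
  have "T (c *\<^sub>R y) = c *\<^sub>R T y" for c y
    using assms(1) by (simp add: bounded_linear.linear linear_scale)
  then show ?thesis
    using assms(2) integrable_bounded_linear[OF assms(1)]
    by (fastforce simp: interval_lebesgue_integrable_def set_integrable_def split: if_splits)
qed

lemma interval_lebesgue_integral_bounded_linear:
  fixes f :: "real \<Rightarrow> 'a::{banach, second_countable_topology}"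
    and T :: "'a \<Rightarrow> 'b::{banach, second_countable_topology}"
  assumes "bounded_linear T" "interval_lebesgue_integrable M a b f"
  shows "interval_lebesgue_integral M a b (\<lambda>x. T (f x)) = T (interval_lebesgue_integral M a b f)"
proof -
  have "T (c *\<^sub>R y) = c *\<^sub>R T y" "T (- y) = - T y" for c y
    using assms(1) by (simp_all add: bounded_linear.linear linear_scale linear_neg)
  then show ?thesis
    using assms(2) integral_bounded_linear[OF assms(1)]
    by (fastforce simp: interval_lebesgue_integral_def interval_lebesgue_integrable_def
        set_integrable_def set_lebesgue_integral_def split: if_splits)
qed

lemma bounded_linear_sandwich:
  fixes X Y :: "complex^'n^'n"
  shows "bounded_linear (\<lambda>Z. X ** Z ** Y)"
  unfolding linear_conv_bounded_linear[symmetric]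
  by (simp add: linear_iff matrix_add_ldistrib matrix_add_mult_distrib matrix_scalar_ac
      flip: scalar_matrix_assoc)

lemma bounded_linear_conj_transpose: "bounded_linear (conj_transpose :: complex^'n^'n \<Rightarrow> _)"
  unfolding linear_conv_bounded_linear[symmetric]
  by (simp add: linear_iff conj_transpose_add conj_transpose_scaleR)

text \<open>
  Expanding both polynomials writes the integrand as a finite sum of fixed linear images of the
  moments $x^{r+s} W(x)$.
\<close>

lemma weight_integrand_integrable:
  fixes W :: "real \<Rightarrow> complex^'n^'n"
  assumes "matrix_weight a b W"
  shows "interval_lebesgue_integrable lborel a b (weight_integrand W (eval_poly F) (eval_poly G))"
proof -
  obtain d where d: "degree_below d F" using ex_degree_below by blast
  obtain e where e: "degree_below e G" using ex_degree_below by blast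
  have expand: "weight_integrand W (eval_poly F) (eval_poly G)
      = (\<lambda>x. \<Sum>s<e. \<Sum>r<d.
          mat_coeff F r ** (x ^ (r + s) *\<^sub>R W x) ** conj_transpose (mat_coeff G s))"
    unfolding fun_eq_iff weight_integrand_def eval_poly_eq_sum[OF d] eval_poly_eq_sum[OF e]
    by (simp add: matrix_sum_mult_distrib matrix_mult_sum_distrib conj_transpose_sum
        conj_transpose_scaleR matrix_scalar_ac power_add scaleR_sum_right ac_simps flip: scalar_matrix_assoc)
  have "interval_lebesgue_integrable lborel a b
      (\<lambda>x. mat_coeff F r ** (x ^ (r + s) *\<^sub>R W x) ** conj_transpose (mat_coeff G s))" for r s
    using assms unfolding matrix_weight_def
    by (intro interval_lebesgue_integrable_bounded_linear[OF bounded_linear_sandwich]) blast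
  then show ?thesis
    unfolding expand interval_lebesgue_integrable_def set_integrable_def
    by (cases "a \<le> b") (simp_all only: if_True if_False scaleR_sum_right
        Bochner_Integration.integrable_sum)
qed

lemma hermitian_form_weight_inner:
  fixes W :: "real \<Rightarrow> complex^'n^'n"
  assumes W: "matrix_weight a b W"
  shows "hermitian_form (\<lambda>F G. weight_inner a b W (eval_poly F) (eval_poly G))"
proof
  note integrable = weight_integrand_integrable[OF W]
  fix F G K :: "'n mat_poly" and c :: "complex^'n^'n"
  have "weight_integrand W (eval_poly (F + G)) (eval_poly K) y
      = weight_integrand W (eval_poly F) (eval_poly K) y
        + weight_integrand W (eval_poly G) (eval_poly K) y" for y
    by (simp add: weight_integrand_def eval_poly_add matrix_add_mult_distrib)
  then show "weight_inner a b W (eval_poly (F + G)) (eval_poly K)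
      = weight_inner a b W (eval_poly F) (eval_poly K)
        + weight_inner a b W (eval_poly G) (eval_poly K)"
    by (simp add: weight_inner_def integrable)
  have "weight_integrand W (eval_poly (const_mat c ** F)) (eval_poly G) y
      = c ** weight_integrand W (eval_poly F) (eval_poly G) y ** mat 1" for y
    by (simp add: weight_integrand_def eval_poly_const_mult matrix_mul_assoc)
  then show "weight_inner a b W (eval_poly (const_mat c ** F)) (eval_poly G)
      = c ** weight_inner a b W (eval_poly F) (eval_poly G)"
    using interval_lebesgue_integral_bounded_linear[OF
        bounded_linear_sandwich[of c "mat 1"] integrable[of F G]]
    by (simp add: weight_inner_def)
  have "AE y in lborel. y \<in> einterval a b \<longrightarrow> pos_def (W y)"
    using W by (simp add: matrix_weight_def)
  then have symmetric: "AE y in lborel.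
      indicator (einterval a b) y *\<^sub>R conj_transpose (weight_integrand W (eval_poly F) (eval_poly G) y)
      = indicator (einterval a b) y *\<^sub>R weight_integrand W (eval_poly G) (eval_poly F) y"
    by eventually_elim (simp add: pos_def_def weight_integrand_def conj_transpose_mult
        matrix_mul_assoc split: split_indicator)
  have "a \<le> b" using W by (simp add: matrix_weight_def less_imp_le)
  then have "(LBINT y=a..b. conj_transpose (weight_integrand W (eval_poly F) (eval_poly G) y))
      = weight_inner a b W (eval_poly G) (eval_poly F)"
    using interval_lebesgue_integrable_bounded_linear[OF bounded_linear_conj_transpose
        integrable[of F G]] integrable[of G F] symmetric
    unfolding weight_inner_def interval_lebesgue_integral_def interval_lebesgue_integrable_def
      set_lebesgue_integral_def set_integrable_def
    by (simp only: if_True) (intro integral_cong_AE borel_measurable_integrable)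
  then show "conj_transpose (weight_inner a b W (eval_poly F) (eval_poly G))
      = weight_inner a b W (eval_poly G) (eval_poly F)"
    using interval_lebesgue_integral_bounded_linear[OF bounded_linear_conj_transpose integrable]
    by (simp add: weight_inner_def)
qed


section \<open>The intertwined difference operators\<close>

theorem corollary3p3:
  fixes a b :: ereal
    and W :: "real \<Rightarrow> complex^'n^'n"
    and P :: "nat \<Rightarrow> 'n mat_poly"
    and H B C :: "nat \<Rightarrow> complex^'n^'n"
    and A :: "complex^'n^'n"
    and v :: "complex poly"
    and k :: nat
    and D D' :: "'n differential_op"
    and M :: "'n difference_op"
  assumes weight: "matrix_weight a b W"
    and mvop: "monic_MVOP a b W P H"
    and recurrence: "three_term_recurrence P B C"
    and k: "k = degree v"
    and D: "D = [:to_rat (const_mat A), mat 1:]"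
    and D': "D' = - D + [:to_rat (mat (pderiv v)):]"
    and adjoint: "is_adjoint a b W D D'"
    and M: "M = (\<lambda>j n. if - int k + 1 \<le> j \<and> j \<le> 0
                        then (if j = 0 then A
                              else difference_poly (pderiv v) (recurrence_op B C) j n)
                        else 0)"
  shows "(\<exists>!M'. M' \<in> fourier_left P \<and> intertwines P M D \<and> intertwines P M' D') \<and>
         (\<forall>M'. M' \<in> fourier_left P \<and> intertwines P M D \<and> intertwines P M' D' \<longrightarrow>
            M' = (\<lambda>i n. if 0 \<le> i \<and> i \<le> int k - 1
                         then H n ** conj_transpose (M (- i) (n + nat i)) ** matrix_inv (H (n + nat i))
                         else 0))"
proof -
  let ?ip = "\<lambda>F G. weight_inner a b W (eval_poly F) (eval_poly G)"
  let ?w = "pderiv v"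
  let ?T = "deriv_plus A" and ?T' = "\<lambda>F. mat (pderiv v) ** F - deriv_plus A F"
  define Md where "Md = (\<lambda>i n. if 0 \<le> i \<and> i \<le> int (degree ?w)
      then H n ** conj_transpose (M (- i) (n + nat i)) ** matrix_inv (H (n + nat i)) else 0)"
  interpret hermitian_form ?ip
    using weight by (rule hermitian_form_weight_inner)
  interpret monic_orthogonal_polynomials ?ip P H
    using mvop by unfold_locales (auto simp: monic_MVOP_def intro: pos_def_invertible)
  have act: "dact F D = to_rat (?T F)" "dact F D' = to_rat (?T' F)" for F
    by (simp_all only: D D' dact_deriv_plus dact_adjoint_deriv_plus)
  have adj: "?ip (?T F) G = ?ip F (?T' G)" for F G
    using adjoint by (simp add: is_adjoint_def act eval_rat_to_rat)
  \<comment> \<open>Without this, \<open>int k - 1\<close> could be negative, whereas \<open>degree ?w\<close> is truncated at zero.\<close>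
  have "?w \<noteq> 0"
    using adj by (rule adjoint_deriv_plus_nonzero)
  then have k': "int k - 1 = int (degree ?w)"
    by (auto simp: k degree_pderiv pderiv_eq_0_iff)
  then have "- int k + 1 = - int (degree ?w)" by linarith
  then have M_alt: "M = (\<lambda>j n. if - int (degree ?w) \<le> j \<and> j \<le> 0
      then (if j = 0 then A else difference_poly ?w (recurrence_op B C) j n) else 0)"
    by (simp only: M)
  note ip_T = ip_deriv_plus_P[OF recurrence adj M_alt]
  have ip_T': "?ip (?T' (P n)) (P m) = Md (int m - int n) n ** H m" for n m
    by (rule ip_adjoint_P[OF adj ip_T _ Md_def]) (auto simp: M_alt)
  have "supp M \<subseteq> {- int (degree ?w)..0}" "supp Md \<subseteq> {0..int (degree ?w)}"
    by (auto simp: supp_def M_alt Md_def split: if_splits)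
  then have fin: "finite (supp M)" "finite (supp Md)"
    by (auto intro: finite_subset)
  have MP: "intertwines P M D" and MdP: "intertwines P Md D'"
    using difference_act_eqI[OF fin(1) ip_T] difference_act_eqI[OF fin(2) ip_T']
    by (simp_all add: intertwines_def act)
  have "is_difference_op Md"
    using fin by (auto simp: is_difference_op_def Md_def)
  then have Md: "Md \<in> fourier_left P"
    using MdP by (auto simp: fourier_left_def)
  have unique: "M' = Md" if "M' \<in> fourier_left P" "intertwines P M' D'" for M'
    using that MdP \<open>is_difference_op Md\<close>
    by (intro difference_act_inject) (auto simp: fourier_left_def intertwines_def to_rat_eq_iff
        simp flip: to_rat_eq_iff)
  show ?thesis
    using MP MdP Md unique unfolding k' Md_def[symmetric] by blast
qed

end
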